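(* Let $(X,d)$ be a metric space and let $f_n:X\to X$, $n\ge 0$, be a sequence of maps, defining the non-autonomous discrete system $x_{n+1}=f_n(x_n)$, $n\ge0$. Assume that there exists an increasing sequence $\{k_n\}_{n=1}^\infty$ of positive integers such that the induced maps $$\hat f_0:=f_{k_1-1}\circ f_{k_1-2}\circ\cdots\circ f_0,\qquad \hat f_n:=f_{k_{n+1}-1}\circ f_{k_{n+1}-2}\circ\cdots\circ f_{k_n}\ (n\ge1)$$ satisfy the following. There are $N\ge2$, an irreducible transition matrix $A=(a_{ij})_{N\times N}$ with $\sum_{j=1}^N a_{i_0j}\ge2$ for some $1\le i_0\le N$, pairwise disjoint nonempty compact subsets $V_1,\dots,V_N$ of $X$ such that $\hat f_n$ is continuous in $\bigcup_{i=1}^N V_i$ for every $n\ge0$, and, for each $1\le i\le N$, a sequence $\{V_{i,n}\}_{n=0}^\infty$ of nonempty closed subsets of $V_i$, such that, with $$V_\alpha^{m,n}:=\bigcap_{k=0}^{m}\hat f_n^{-k}(V_{a_k,n+k}),\qquad \alpha=(a_0,a_1,\dots)\in\Sigma_N^+(A),\ m,n\ge0,$$ (i) the system $\hat x_{n+1}=\hat f_n(\hat x_n)$, $n\ge0$, is weakly $A$-coupled-expanding in $\{V_{i,n}\}_{n=0}^\infty$, $1\le i\le N$; (ii) there exist $\beta=(b_0,b_1,\dots)\in\Sigma_N^+(A)$, an increasing sequence $\{m_k\}_{k=1}^\infty$ of positive integers, and $1\le s_0\le N$ such that $b_{m_k}=s_0$ for all $k\ge1$, and such that for every increasing sequence $\{n_k\}_{k=1}^\infty$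 of nonnegative integers, the diameter $d(V_\beta^{m_k,n_k})$ converges to $0$ as $k\to\infty$. Then the system $x_{n+1}=f_n(x_n)$, $n\ge0$, is Li-Yorke $\delta$-chaotic for some $\delta>0$. Further, if $X$ is bounded, then the system $x_{n+1}=f_n(x_n)$, $n\ge0$, is chaotic in the strong sense of Li-Yorke.
   Context: Notation: for $n\ge1$, $f_0^n:=f_{n-1}\circ\cdots\circ f_0$, and $f_0^0$ is the identity. Similarly, for $i\ge0$, $n\ge1$, $\hat f_i^n:=\hat f_{i+n-1}\circ\cdots\circ \hat f_i$, $\hat f_i^0$ is the identity, and $\hat f_i^{-n}(B)=\{x\in X:\hat f_i^n(x)\in B\}$. For a nonempty set $B\subset X$, $d(B):=\sup\{d(x,y):x,y\in B\}$ is its diameter. "Increasing" means strictly increasing. "Continuous in $\bigcup_i V_i$" means that the restriction to this set is continuous. A matrix $A=(a_{ij})_{N\times N}$ ($N\ge2$) is a transition matrix if $a_{ij}\in\{0,1\}$ for all $i,j$, $\sum_{j}a_{ij}\ge1$ for all $i$, and $\sum_i a_{ij}\ge1$ for all $j$. It is irreducible if for each pair $1\le i,j\le N$ there is a positive integer $k$ such that the $(i,j)$ entry of $A^k$ is positive. $\Sigma_N^+(A):=\{(s_0,s_1,\dots): 1\le s_j\le N,\ a_{s_js_{j+1}}=1,\ j\ge0\}$. For a system $x_{n+1}=g_n(x_n)$, $n\ge0$, with maps $g_n:X\to X$, and sequences $\{V_{i,n}\}_{n\ge0}$, $1\le i\le N$, of nonempty subsets of $X$ with $V_{i,n}\cap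 V_{j,n}=\partial V_{i,n}\cap\partial V_{j,n}$ for all $i\ne j$ and $n\ge0$ ($\partial$ denotes boundary), the system is weakly $A$-coupled-expanding in $\{V_{i,n}\}_{n=0}^\infty$, $1\le i\le N$, if $g_n(V_{i,n})\supset\bigcup_{j:\,a_{ij}=1}V_{j,n+1}$ for all $1\le i\le N$, $n\ge0$. The system $x_{n+1}=f_n(x_n)$ is Li-Yorke $\delta$-chaotic ($\delta>0$) if there is an uncountable set $S\subset X$ such that for all distinct $x,y\in S$, $\liminf_{n\to\infty}d(f_0^n(x),f_0^n(y))=0$ and $\limsup_{n\to\infty}d(f_0^n(x),f_0^n(y))>\delta$. It is chaotic in the strong sense of Li-Yorke if, for some $\delta>0$, there is such a set $S$ for which, in addition, every orbit $\{f_0^n(x)\}_{n\ge0}$, $x\in S$, is bounded. *)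

theory Defs
  imports "HOL-Analysis.Analysis" "Jordan_Normal_Form.Matrix"
begin

text \<open>
  The metric space is the whole type (class \<open>metric_space\<close>).
  The symbols \<open>1, \<dots>, N\<close> are represented by \<open>0, \<dots>, N - 1\<close>, as matrix indices start at 0.
  Sequences that are indexed from 1 keep that indexing: their value at 0 is irrelevant.
\<close>

text \<open>\<open>iter_from g i n\<close> is \<open>g\<^sub>i\<^sup>n = g (i + n - 1) \<circ> \<dots> \<circ> g i\<close>.\<close>

primrec iter_from :: "(nat \<Rightarrow> 'a \<Rightarrow> 'a) \<Rightarrow> nat \<Rightarrow> nat \<Rightarrow> 'a \<Rightarrow> 'a" where
  "iter_from g i 0 = id"
| "iter_from g i (Suc n) = g (i + n) \<circ> iter_from g i n"

text \<open>The map \<open>f (k (n + 1) - 1) \<circ> \<dots> \<circ> f (k n)\<close>, where \<open>k 0\<close> is read as 0.\<close>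

definition induced_map :: "(nat \<Rightarrow> 'a \<Rightarrow> 'a) \<Rightarrow> (nat \<Rightarrow> nat) \<Rightarrow> nat \<Rightarrow> 'a \<Rightarrow> 'a" where
  "induced_map f k n =
     (if n = 0 then iter_from f 0 (k 1) else iter_from f (k n) (k (n + 1) - k n))"

definition transition_matrix :: "nat \<Rightarrow> nat mat \<Rightarrow> bool" where
  "transition_matrix N A \<longleftrightarrow>
     N \<ge> 2 \<and> A \<in> carrier_mat N N \<and>
     (\<forall>i<N. \<forall>j<N. A $$ (i, j) \<in> {0, 1}) \<and>
     (\<forall>i<N. (\<Sum>j<N. A $$ (i, j)) \<ge> 1) \<and>
     (\<forall>j<N. (\<Sum>i<N. A $$ (i, j)) \<ge> 1)"

definition irreducible_matrix :: "nat \<Rightarrow> nat mat \<Rightarrow> bool" where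
  "irreducible_matrix N A \<longleftrightarrow> (\<forall>i<N. \<forall>j<N. \<exists>k>0. (A ^\<^sub>m k) $$ (i, j) > 0)"

definition one_sided_shift :: "nat \<Rightarrow> nat mat \<Rightarrow> (nat \<Rightarrow> nat) set" where
  "one_sided_shift N A = {s. \<forall>j. s j < N \<and> A $$ (s j, s (Suc j)) = 1}"

definition weakly_coupled_expanding ::
  "nat \<Rightarrow> nat mat \<Rightarrow> (nat \<Rightarrow> 'a::topological_space \<Rightarrow> 'a) \<Rightarrow> (nat \<Rightarrow> nat \<Rightarrow> 'a set) \<Rightarrow> bool" where
  "weakly_coupled_expanding N A g W \<longleftrightarrow>
     (\<forall>i<N. \<forall>n. W i n \<noteq> {}) \<and>
     (\<forall>i<N. \<forall>j<N. i \<noteq> j \<longrightarrow>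
        (\<forall>n. W i n \<inter> W j n = frontier (W i n) \<inter> frontier (W j n))) \<and>
     (\<forall>i<N. \<forall>n. (\<Union>j\<in>{j. j < N \<and> A $$ (i, j) = 1}. W j (Suc n)) \<subseteq> g n ` W i n)"

text \<open>The set \<open>V\<^sub>\<alpha>\<close> with superscripts \<open>m, n\<close>, for the maps \<open>g\<close> and the sets \<open>W\<close>.\<close>

definition itinerary_set ::
  "(nat \<Rightarrow> 'a \<Rightarrow> 'a) \<Rightarrow> (nat \<Rightarrow> nat \<Rightarrow> 'a set) \<Rightarrow> (nat \<Rightarrow> nat) \<Rightarrow> nat \<Rightarrow> nat \<Rightarrow> 'a set" where
  "itinerary_set g W \<alpha> m n = (\<Inter>k\<in>{..m}. iter_from g n k -` W (\<alpha> k) (n + k))"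

text \<open>Lower and upper limits are taken in \<^typ>\<open>ereal\<close>, as distances may be unbounded along orbits.\<close>

definition scrambled_set :: "(nat \<Rightarrow> 'a::metric_space \<Rightarrow> 'a) \<Rightarrow> real \<Rightarrow> 'a set \<Rightarrow> bool" where
  "scrambled_set f \<delta> S \<longleftrightarrow>
     uncountable S \<and>
     (\<forall>x\<in>S. \<forall>y\<in>S. x \<noteq> y \<longrightarrow>
        liminf (\<lambda>n. ereal (dist (iter_from f 0 n x) (iter_from f 0 n y))) = 0 \<and>
        limsup (\<lambda>n. ereal (dist (iter_from f 0 n x) (iter_from f 0 n y))) > ereal \<delta>)"

definition li_yorke_chaotic :: "(nat \<Rightarrow> 'a::metric_space \<Rightarrow> 'a) \<Rightarrow> real \<Rightarrow> bool" where
  "li_yorke_chaotic f \<delta> \<longleftrightarrow> \<delta> > 0 \<and> (\<exists>S. scrambled_set f \<delta> S)"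

definition strong_li_yorke_chaotic :: "(nat \<Rightarrow> 'a::metric_space \<Rightarrow> 'a) \<Rightarrow> bool" where
  "strong_li_yorke_chaotic f \<longleftrightarrow>
     (\<exists>\<delta>>0. \<exists>S. scrambled_set f \<delta> S \<and> (\<forall>x\<in>S. bounded (range (\<lambda>n. iter_from f 0 n x))))"

end

theory Submission
  imports Defs
begin

text \<open>
  If \<open>i\<close> has two successors \<open>j0\<close> and \<open>j1\<close>, then irreducibility gives closed walks \<open>c0\<close> and \<open>c1\<close>
  at \<open>i\<close> that start with \<open>j0\<close> and \<open>j1\<close>. The products \<open>c0 c1\<close> and \<open>c1 c0\<close> have the same length and
  differ in their first step, so a bit can be encoded without changing the timing of what follows.
  For each bit sequence there is hence an itinerary that alternates between an encoded bit and a
  longer and longer initial piece of \<open>\<beta>\<close>, at times that do not depend on the bits. Every itinerary is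
  realised by a point (coupled expansion and compactness). Two such points come arbitrarily close
  along the pieces of \<open>\<beta>\<close>, and are separated by the disjoint compact sets \<open>V j0\<close> and \<open>V j1\<close>
  whenever their bits differ. Every bit is repeated infinitely often, so that any two different
  bit sequences are separated infinitely often.
\<close>

section \<open>Walks in a directed graph and their concatenation\<close>

definition walk :: "('b \<Rightarrow> 'b \<Rightarrow> bool) \<Rightarrow> (nat \<Rightarrow> 'b) \<Rightarrow> nat \<Rightarrow> 'b \<Rightarrow> 'b \<Rightarrow> bool" where
  "walk R p n x y \<longleftrightarrow> p 0 = x \<and> p n = y \<and> (\<forall>t<n. R (p t) (p (Suc t)))"

text \<open>At \<open>t = a\<close> the two descriptions of \<open>r\<close> overlap; they agree
  because both walks pass through \<open>y\<close>.\<close>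

lemma walk_append:
  assumes p: "walk R p a x y" and q: "walk R q b y z"
  obtains r where "walk R r (a + b) x z" "\<And>t. t \<le> a \<Longrightarrow> r t = p t" "\<And>t. r (a + t) = q t"
proof -
  define r where "r t = (if t \<le> a then p t else q (t - a))" for t
  have r1: "r t = p t" if "t \<le> a" for t
    using that by (simp add: r_def)
  have r2: "r (a + t) = q t" for t
    using p q by (cases t) (auto simp: r_def walk_def)
  have "R (r t) (r (Suc t))" if "t < a + b" for t
  proof (cases "t < a")
    case True
    then show ?thesis using p by (simp add: r1 walk_def)
  next
    case False
    then obtain u where t: "t = a + u" by (metis le_Suc_ex not_less)
    have "R (q u) (q (Suc u))" using q that t by (simp add: walk_def)
    then show ?thesis using r2[of u] r2[of "Suc u"] t by simp
  qed
  moreover have "r 0 = x" using p r1[of 0] by (simp add: walk_def)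
  moreover have "r (a + b) = z" using q r2[of b] by (simp add: walk_def)
  ultimately have "walk R r (a + b) x z" by (simp add: walk_def)
  then show ?thesis using that r1 r2 by blast
qed

text \<open>All walks share the base point \<open>x\<close>, so the end of block \<open>k\<close> is
  also the start of block \<open>k + 1\<close>. The starting times depend only on the lengths
  \<open>l\<close>, which keeps the timing independent of the contents of the blocks.\<close>

lemma closed_walks_concat:
  fixes l :: "nat \<Rightarrow> nat"
  assumes walks: "\<And>k. walk R (p k) (l k) x x" and pos: "\<And>k. l k > 0"
  obtains \<alpha> where "\<And>t. R (\<alpha> t) (\<alpha> (Suc t))"
    and "\<And>k t. t \<le> l k \<Longrightarrow> \<alpha> (sum l {..<k} + t) = p k t"
proof -
  define s where "s k = sum l {..<k}" for k
  have s_Suc: "s (Suc k) = s k + l k" for k by (simp add: s_def)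
  have "strict_mono s" using pos by (simp add: strict_mono_Suc_iff s_Suc)
  \<comment> \<open>\<open>b t\<close> is the number of the block that contains time
    \<open>t\<close>; a boundary time belongs to the block that starts there.\<close>
  define b where "b t = (LEAST k. t < s (Suc k))" for t
  define \<alpha> where "\<alpha> t = p (b t) (t - s (b t))" for t
  have b: "b (s k + t) = k" if "t < l k" for k t
    unfolding b_def
  proof (rule Least_equality)
    show "s k + t < s (Suc k)" using that by (simp add: s_Suc)
    show "k \<le> j" if "s k + t < s (Suc j)" for j
    proof -
      have "s k < s (Suc j)" using that by simp
      then have "k < Suc j" using \<open>strict_mono s\<close> strict_mono_less by blast
      then show ?thesis by simp
    qed
  qed
  have inner: "\<alpha> (s k + t) = p k t" if "t < l k" for k t
    using b[OF that] by (simp add: \<alpha>_def)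
  have eq: "\<alpha> (s k + t) = p k t" if "t \<le> l k" for k t
  proof (cases "t = l k")
    case True
    have "\<alpha> (s k + t) = \<alpha> (s (Suc k) + 0)" using True by (simp add: s_Suc)
    also have "\<dots> = p (Suc k) 0" by (rule inner) (rule pos)
    also have "\<dots> = p k t" using walks[of k] walks[of "Suc k"] True by (simp add: walk_def)
    finally show ?thesis .
  next
    case False
    then show ?thesis using that inner by simp
  qed
  have "R (\<alpha> t) (\<alpha> (Suc t))" for t
  proof -
    \<comment> \<open>A witness for the \<open>LEAST\<close> in \<open>b t\<close>: a strictly
      increasing \<open>s\<close> has \<open>Suc t \<le> s (Suc t)\<close>.\<close>
    have "t < s (Suc t)"
      using strict_mono_imp_increasing[OF \<open>strict_mono s\<close>, of "Suc t"] by simp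
    then have lt: "t < s (Suc (b t))" unfolding b_def by (rule LeastI)
    have ge: "s (b t) \<le> t"
    proof (cases "b t")
      case 0
      then show ?thesis by (simp add: s_def)
    next
      case (Suc j)
      then have "\<not> t < s (Suc j)" using not_less_Least[of j "\<lambda>k. t < s (Suc k)"] b_def by simp
      then show ?thesis using Suc by simp
    qed
    define u where "u = t - s (b t)"
    have u: "t = s (b t) + u" "u < l (b t)" using lt ge by (auto simp: u_def s_Suc)
    have "R (p (b t) u) (p (b t) (Suc u))" using walks[of "b t"] u by (simp add: walk_def)
    moreover have "\<alpha> t = p (b t) u" by (simp add: \<alpha>_def u_def)
    moreover have "\<alpha> (Suc t) = p (b t) (Suc u)" using eq[of "Suc u" "b t"] u by simp
    ultimately show ?thesis by simp
  qed
  then show ?thesis using that eq unfolding s_def by blast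
qed

lemma exists_two_closed_walks:
  assumes conn: "\<And>x y. x \<in> D \<Longrightarrow> y \<in> D \<Longrightarrow> \<exists>n p. walk R p n x y"
    and "i \<in> D" "j0 \<in> D" "j1 \<in> D" "R i j0" "R i j1"
  obtains n p q where "n > 0" "walk R p n i i" "walk R q n i i" "p 1 = j0" "q 1 = j1"
proof -
  have loop: "\<exists>n p. walk R p n i i \<and> n \<ge> 1 \<and> p 1 = j" if "j \<in> D" "R i j" for j
  proof -
    obtain n p where p: "walk R p n j i" using conn[OF \<open>j \<in> D\<close> \<open>i \<in> D\<close>] by blast
    \<comment> \<open>The extra first step fixes position 1 and makes the length positive even if
      the return walk \<open>p\<close> has length 0.\<close>
    have "walk R (\<lambda>t. if t = 0 then i else j) 1 i j" using that by (simp add: walk_def)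
    then obtain r where "walk R r (1 + n) i i" "\<And>t. t \<le> 1 \<Longrightarrow> r t = (if t = 0 then i else j)"
      using p by (rule walk_append) blast
    then show ?thesis by (intro exI[of _ "1 + n"] exI[of _ r]) simp
  qed
  obtain a p where p: "walk R p a i i" "a \<ge> 1" "p 1 = j0" using loop assms by blast
  obtain b q where q: "walk R q b i i" "b \<ge> 1" "q 1 = j1" using loop assms by blast
  obtain u where u: "walk R u (a + b) i i" "\<And>t. t \<le> a \<Longrightarrow> u t = p t"
    using walk_append[OF p(1) q(1)] by metis
  obtain v where v: "walk R v (b + a) i i" "\<And>t. t \<le> b \<Longrightarrow> v t = q t"
    using walk_append[OF q(1) p(1)] by metis
  show ?thesis
    by (rule that[of "a + b" u v]) (use u v p q in \<open>auto simp: add.commute\<close>)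
qed

text \<open>The order of quantifiers is the point: \<open>n\<close> and \<open>q\<close> are chosen
  before \<open>\<omega>\<close>, so all itineraries follow \<open>\<beta>\<close> at the same times
  and show their bits at the same times.\<close>

lemma exists_itineraries:
  fixes m :: "nat \<Rightarrow> nat"
  assumes conn: "\<And>x y. x \<in> D \<Longrightarrow> y \<in> D \<Longrightarrow> \<exists>n p. walk R p n x y"
    and D: "i \<in> D" "j0 \<in> D" "j1 \<in> D" and R: "R i j0" "R i j1"
    and \<beta>: "\<And>t. \<beta> t \<in> D" "\<And>t. R (\<beta> t) (\<beta> (Suc t))"
  obtains n q where "strict_mono n" "strict_mono q"
    and "\<And>\<omega> :: nat \<Rightarrow> bool. \<exists>\<alpha>. (\<forall>t. R (\<alpha> t) (\<alpha> (Suc t))) \<and> (\<forall>k. \<forall>t\<le>m k. \<alpha> (n k + t) = \<beta> t) \<and>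
               (\<forall>k. \<alpha> (q k) = (if \<omega> k then j1 else j0))"
proof -
  obtain L u v where L: "L > 0" and u: "walk R u L i i" "u 1 = j0"
    and v: "walk R v L i i" "v 1 = j1"
    using exists_two_closed_walks[OF conn D R] by metis
  obtain c p where p: "walk R p c i (\<beta> 0)" using conn D(1) \<beta>(1) by blast
  have "\<exists>d q. walk R q d (\<beta> (m k)) i" for k using conn D(1) \<beta>(1) by blast
  then obtain d q where q: "\<And>k. walk R (q k) (d k) (\<beta> (m k)) i" by metis
  have w\<beta>: "walk R \<beta> (m k) (\<beta> 0) (\<beta> (m k))" for k using \<beta> by (simp add: walk_def)
  \<comment> \<open>Layout of block \<open>k\<close>: \<open>L\<close> steps encode the bit,
    \<open>c\<close> steps lead from \<open>i\<close> to \<open>\<beta> 0\<close>,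
    \<open>m k\<close> steps follow \<open>\<beta>\<close>, and \<open>d k\<close> steps return to
    \<open>i\<close>. No summand depends on the bit.\<close>
  define l where "l k = L + (c + (m k + d k))" for k :: nat
  have block: "\<exists>r. walk R r (l k) i i \<and> r 1 = (if e then j1 else j0) \<and>
                   (\<forall>t\<le>m k. r (L + c + t) = \<beta> t)" for k e
  proof -
    define w where "w = (if e then v else u)"
    have w: "walk R w L i i" "w 1 = (if e then j1 else j0)" using u v by (auto simp: w_def)
    obtain r1 where r1: "walk R r1 (m k + d k) (\<beta> 0) i" "\<And>t. t \<le> m k \<Longrightarrow> r1 t = \<beta> t"
      using walk_append[OF w\<beta> q] by metis
    obtain r2 where r2: "walk R r2 (c + (m k + d k)) i i" "\<And>t. r2 (c + t) = r1 t"
      using walk_append[OF p r1(1)] by metis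
    obtain r3 where r3: "walk R r3 (l k) i i" "\<And>t. t \<le> L \<Longrightarrow> r3 t = w t"
        "\<And>t. r3 (L + t) = r2 t"
      using walk_append[OF w(1) r2(1)] unfolding l_def by metis
    have "r3 1 = (if e then j1 else j0)" using r3(2)[of 1] L w(2) by simp
    moreover have "\<forall>t\<le>m k. r3 (L + c + t) = \<beta> t"
      using r1(2) r2(2) r3(3) by (simp add: add.assoc)
    ultimately show ?thesis using r3(1) by blast
  qed
  then obtain B where B: "\<And>k e. walk R (B k e) (l k) i i"
      "\<And>k e. B k e 1 = (if e then j1 else j0)"
      "\<And>k e t. t \<le> m k \<Longrightarrow> B k e (L + c + t) = \<beta> t"
    by metis
  have l_pos: "l k > 0" for k using L by (simp add: l_def)
  define s where "s k = sum l {..<k}" for k :: nat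
  have s: "strict_mono s" using l_pos by (simp add: strict_mono_Suc_iff s_def)
  show ?thesis
  proof (rule that)
    \<comment> \<open>In block \<open>k\<close> the piece of \<open>\<beta>\<close> begins after
      \<open>L + c\<close> steps, and the bit is visible one step after the start.\<close>
    show "strict_mono (\<lambda>k. s k + (L + c))" "strict_mono (\<lambda>k. s k + 1)"
      using s by (simp_all add: strict_mono_def)
    fix \<omega> :: "nat \<Rightarrow> bool"
    obtain \<alpha> where \<alpha>: "\<And>t. R (\<alpha> t) (\<alpha> (Suc t))"
        "\<And>k t. t \<le> l k \<Longrightarrow> \<alpha> (s k + t) = B k (\<omega> k) t"
      using closed_walks_concat[of R "\<lambda>k. B k (\<omega> k)" l i] B(1) l_pos unfolding s_def by metis
    have "\<alpha> (s k + (L + c) + t) = \<beta> t" if "t \<le> m k" for k t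
      using \<alpha>(2)[of "L + c + t" k] B(3)[OF that] that by (simp add: l_def add.assoc)
    moreover have "\<alpha> (s k + 1) = (if \<omega> k then j1 else j0)" for k
      using \<alpha>(2)[of 1 k] B(2) l_pos[of k] by simp
    ultimately show "\<exists>\<alpha>. (\<forall>t. R (\<alpha> t) (\<alpha> (Suc t))) \<and>
        (\<forall>k. \<forall>t\<le>m k. \<alpha> (s k + (L + c) + t) = \<beta> t) \<and>
        (\<forall>k. \<alpha> (s k + 1) = (if \<omega> k then j1 else j0))"
      using \<alpha>(1) by blast
  qed
qed

section \<open>From powers of the matrix to walks\<close>

lemma pow_mat_pos_imp_walk:
  fixes A :: "nat mat"
  assumes A: "A \<in> carrier_mat N N"
  shows "i < N \<Longrightarrow> j < N \<Longrightarrow> (A ^\<^sub>m n) $$ (i, j) > 0 \<Longrightarrow>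
    \<exists>p. walk (\<lambda>x y. x < N \<and> y < N \<and> A $$ (x, y) > 0) p n i j"
proof (induction n arbitrary: j)
  case 0
  then have "i = j" using A by (cases "i = j") auto
  then show ?case by (auto simp: walk_def)
next
  case (Suc n)
  have P: "A ^\<^sub>m n \<in> carrier_mat N N" using A by simp
  have "(A ^\<^sub>m Suc n) $$ (i, j) = (\<Sum>x<N. (A ^\<^sub>m n) $$ (i, x) * A $$ (x, j))"
    using A P Suc.prems by (simp add: scalar_prod_def atLeast0LessThan)
  then obtain x where x: "x < N" "(A ^\<^sub>m n) $$ (i, x) * A $$ (x, j) > 0"
    using Suc.prems(3) by (metis (no_types, lifting) gr0I lessThan_iff not_gr0 sum.neutral)
  then obtain p where p: "walk (\<lambda>x y. x < N \<and> y < N \<and> A $$ (x, y) > 0) p n i x"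
    using Suc.IH[of x] Suc.prems(1) by auto
  have "walk (\<lambda>x y. x < N \<and> y < N \<and> A $$ (x, y) > 0) (\<lambda>t. if t = 0 then x else j) 1 x j"
    using x Suc.prems by (simp add: walk_def)
  from walk_append[OF p this] show ?case by (metis Suc_eq_plus1)
qed

section \<open>Iterates of the induced maps, and points with a prescribed itinerary\<close>

lemma iter_from_add: "iter_from g i (m + n) = iter_from g (i + m) n \<circ> iter_from g i m"
  by (induction n) (auto simp: fun_eq_iff add.assoc)

text \<open>The compositions telescope. Time 0 is treated apart because \<open>k\<close> counts from
  1.\<close>

lemma iter_from_induced_map:
  assumes "strict_mono_on {1..} k"
  shows "iter_from (induced_map f k) 0 n = iter_from f 0 (if n = 0 then 0 else k n)"
proof (induction n)
  case (Suc n)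
  show ?case
  proof (cases "n = 0")
    case False
    have "k n < k (Suc n)" using strict_mono_onD[OF assms, of n "Suc n"] False by simp
    then show ?thesis
      using Suc False iter_from_add[of f 0 "k n" "k (Suc n) - k n"] by (simp add: induced_map_def)
  qed (simp add: induced_map_def)
qed simp

text \<open>The points that follow \<open>\<alpha>\<close> up to time \<open>n\<close> form a
  decreasing sequence of nonempty compact sets, and a point common to all of them follows
  \<open>\<alpha>\<close> forever.\<close>

lemma exists_point_of_itinerary:
  fixes g :: "nat \<Rightarrow> 'a::metric_space \<Rightarrow> 'a"
  assumes compact: "\<And>i. i \<in> D \<Longrightarrow> compact (V i)"
    and cont: "\<And>n. continuous_on (\<Union>i\<in>D. V i) (g n)"
    and W: "\<And>i n. i \<in> D \<Longrightarrow> W i n \<noteq> {} \<and> closed (W i n) \<and> W i n \<subseteq> V i"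
    and \<alpha>: "\<And>t. \<alpha> t \<in> D"
    and cover: "\<And>t. W (\<alpha> (Suc t)) (Suc t) \<subseteq> g t ` W (\<alpha> t) t"
  obtains x where "\<And>t. iter_from g 0 t x \<in> W (\<alpha> t) t"
proof -
  define K where "K n = {x. \<forall>t\<le>n. iter_from g 0 t x \<in> W (\<alpha> t) t}" for n
  have K_Suc: "K (Suc n) = K n \<inter> iter_from g 0 (Suc n) -` W (\<alpha> (Suc n)) (Suc n)" for n
    by (auto simp: K_def le_Suc_eq)
  have in_U: "W (\<alpha> t) t \<subseteq> (\<Union>i\<in>D. V i)" for t using W \<alpha> by blast
  \<comment> \<open>One more iterate than \<open>K n\<close> controls is still continuous: at time
    \<open>n\<close> the points of \<open>K n\<close> lie in the domain where \<open>g n\<close> is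
    continuous.\<close>
  have iter_cont: "continuous_on (K n) (iter_from g 0 t)" if "t \<le> Suc n" for n t
    using that
  proof (induction t)
    case (Suc t)
    have "iter_from g 0 t ` K n \<subseteq> (\<Union>i\<in>D. V i)" using in_U Suc.prems by (fastforce simp: K_def)
    then have "continuous_on (iter_from g 0 t ` K n) (g t)" using cont continuous_on_subset by blast
    then show ?case using Suc by (simp add: continuous_on_compose del: comp_apply)
  qed (simp add: id_def)
  have K_closed: "closed (K n)" for n
  proof (induction n)
    case 0
    then show ?case using W \<alpha> by (simp add: K_def)
  next
    case (Suc n)
    have "closed (W (\<alpha> (Suc n)) (Suc n))" using W \<alpha> by blast
    then show ?case unfolding K_Suc
      by (rule continuous_closed_preimage[OF iter_cont[OF order_refl] Suc])
  qed
  have "K n \<subseteq> V (\<alpha> 0)" for n using W \<alpha> by (fastforce simp: K_def)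
  then have K_compact: "compact (K n)" for n
    using K_closed compact[OF \<alpha>] by (metis compact_Int_closed inf.absorb_iff2)
  \<comment> \<open>Nonemptiness comes from pulling a point of the last set back along the covering
    relation, one map at a time.\<close>
  have reach: "\<exists>x\<in>K n. iter_from g 0 n x = y" if "y \<in> W (\<alpha> n) n" for n y
    using that
  proof (induction n arbitrary: y)
    case 0
    then show ?case by (auto simp: K_def)
  next
    case (Suc n)
    then obtain z where "z \<in> W (\<alpha> n) n" "y = g n z" using cover by blast
    with Suc show ?case unfolding K_Suc by fastforce
  qed
  have K_ne: "K n \<noteq> {}" for n using reach W \<alpha> by blast
  have K_mono: "K n \<subseteq> K m" if "m \<le> n" for m n using that by (auto simp: K_def)
  have "\<Inter> (range K) \<noteq> {}"
  proof -
    \<comment> \<open>The finite intersection property is applied inside the compact set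
      \<open>K 0\<close>.\<close>
    have "K 0 \<inter> \<Inter> (range K) \<noteq> {}"
    proof (rule compact_imp_fip[OF K_compact])
      fix F assume F: "finite F" "F \<subseteq> range K"
      then obtain I where I: "finite I" "F = K ` I" by (meson finite_subset_image)
      obtain b where "\<And>i. i \<in> I \<Longrightarrow> i \<le> b" using I(1) by (meson finite_nat_set_iff_bounded_le)
      then have "K b \<subseteq> K 0 \<inter> \<Inter> F" using K_mono I(2) by blast
      then show "K 0 \<inter> \<Inter> F \<noteq> {}" using K_ne by blast
    qed (use K_closed in auto)
    then show ?thesis by blast
  qed
  then obtain x where "\<And>n. x \<in> K n" by blast
  then show ?thesis using that unfolding K_def by blast
qed

section \<open>Lower and upper limits, and auxiliary facts on bits, row sums and itineraries\<close>

lemma liminf_eq_0_of_subseq: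
  fixes u :: "nat \<Rightarrow> real"
  assumes "\<And>n. u n \<ge> 0" "strict_mono r" "(\<lambda>n. u (r n)) \<longlonglongrightarrow> 0"
  shows "liminf (\<lambda>n. ereal (u n)) = 0"
proof (rule antisym)
  have "(\<lambda>n. ereal (u (r n))) \<longlonglongrightarrow> 0" using assms(3) by (simp add: zero_ereal_def)
  then have "liminf (\<lambda>n. ereal (u (r n))) = 0" by (simp add: lim_imp_Liminf)
  then show "liminf (\<lambda>n. ereal (u n)) \<le> 0"
    using liminf_subseq_mono[OF assms(2), of "\<lambda>n. ereal (u n)"] by (simp add: o_def)
  show "0 \<le> liminf (\<lambda>n. ereal (u n))" by (rule Liminf_bounded) (simp add: assms(1))
qed

lemma le_limsup_of_infinitely_often:
  fixes u :: "nat \<Rightarrow> 'b::complete_linorder"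
  assumes "\<And>n. \<exists>m\<ge>n. c \<le> u m"
  shows "c \<le> limsup u"
  unfolding limsup_INF_SUP using assms by (meson INF_greatest SUP_upper2 atLeast_iff)

text \<open>This is the schedule of the bits: block \<open>j\<close> encodes bit number
  \<open>fst (prod_decode j)\<close>, so every bit recurs in infinitely many blocks.\<close>

lemma infinitely_often_fst_prod_decode: "\<exists>m\<ge>n. fst (prod_decode m) = c"
  by (intro exI[of _ "prod_encode (c, n)"]) (simp add: le_prod_encode_2)

lemma sum_ge_2_imp_two_ones:
  fixes a :: "'b \<Rightarrow> nat"
  assumes "finite I" "\<And>j. j \<in> I \<Longrightarrow> a j \<in> {0, 1}" "sum a I \<ge> 2"
  obtains j0 j1 where "j0 \<in> I" "j1 \<in> I" "j0 \<noteq> j1" "a j0 = 1" "a j1 = 1"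
proof -
  obtain j0 where j0: "j0 \<in> I" "a j0 \<noteq> 0"
    using assms(3) by (metis not_numeral_le_zero sum.neutral)
  then have a0: "a j0 = 1" using assms(2) by force
  have "sum a I = a j0 + sum a (I - {j0})" using assms(1) j0(1) by (rule sum.remove)
  then have "sum a (I - {j0}) \<noteq> 0" using assms(3) a0 by simp
  then obtain j1 where j1: "j1 \<in> I - {j0}" "a j1 \<noteq> 0" by (meson sum.neutral)
  then have "a j1 = 1" using assms(2) by force
  then show ?thesis using that j0 j1 a0 by blast
qed

lemma itinerary_setI:
  assumes "\<And>t. iter_from g 0 t x \<in> W (\<alpha> t) t" "\<And>t. t \<le> m \<Longrightarrow> \<alpha> (n + t) = \<beta> t"
  shows "iter_from g 0 n x \<in> itinerary_set g W \<beta> m n"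
  unfolding itinerary_set_def
proof (intro INT_I vimageI2)
  fix t assume "t \<in> {..m}"
  then show "iter_from g n t (iter_from g 0 n x) \<in> W (\<beta> t) (n + t)"
    using assms(1)[of "n + t"] assms(2)[of t] iter_from_add[of g 0 n t] by simp
qed

section \<open>Uncountability, separation and scrambled sets\<close>

lemma uncountable_UNIV_nat_bool: "uncountable (UNIV :: (nat \<Rightarrow> bool) set)"
proof
  assume "countable (UNIV :: (nat \<Rightarrow> bool) set)"
  then obtain g :: "nat \<Rightarrow> nat \<Rightarrow> bool" where "range g = UNIV"
    by (metis UNIV_not_empty range_from_nat_into)
  \<comment> \<open>Cantor's diagonal sequence differs from \<open>g n\<close> at position
    \<open>n\<close>.\<close>
  then obtain n where "g n = (\<lambda>m. \<not> g m m)" by (metis UNIV_I imageE)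
  then show False by (metis (full_types))
qed

text \<open>The distance attains its minimum on the compact product \<open>S \<times> T\<close>, and
  disjointness makes it positive; if there are no pairs, any \<open>e\<close> serves.\<close>

lemma separate_compact_compact:
  fixes S T :: "'a::metric_space set"
  assumes "compact S" "compact T" "S \<inter> T = {}"
  obtains e where "e > 0" "\<And>x y. x \<in> S \<Longrightarrow> y \<in> T \<Longrightarrow> e \<le> dist x y"
proof (cases "S \<times> T = {}")
  case True
  then show ?thesis using that[of 1] by auto
next
  case False
  have "continuous_on (S \<times> T) (\<lambda>z. dist (fst z) (snd z))" by (intro continuous_intros)
  then obtain z where z: "z \<in> S \<times> T" "\<forall>w\<in>S \<times> T. dist (fst z) (snd z) \<le> dist (fst w) (snd w)"
    using continuous_attains_inf[OF compact_Times[OF assms(1,2)] False] by blast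
  have "dist (fst z) (snd z) > 0" using z(1) assms(3) by auto
  moreover have "dist (fst z) (snd z) \<le> dist x y" if "x \<in> S" "y \<in> T" for x y
    using z(2)[rule_format, of "(x, y)"] that by simp
  ultimately show ?thesis by (rule that)
qed

text \<open>\<open>r\<close> converts the time of the induced system into the time of
  \<open>f\<close>. The times \<open>n j\<close> give the lower limit, the times \<open>q j\<close>
  the upper limit; \<open>far\<close> also makes \<open>x\<close> injective, so that its range is
  uncountable.\<close>

lemma scrambled_set_of_itineraries:
  fixes f :: "nat \<Rightarrow> 'a::metric_space \<Rightarrow> 'a"
    and x :: "(nat \<Rightarrow> bool) \<Rightarrow> 'a"
    and r n q :: "nat \<Rightarrow> nat"
  assumes r: "strict_mono r" and n: "strict_mono n" and q: "strict_mono q"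
    and close: "\<And>j \<omega> \<omega>'. dist (iter_from f 0 (r (n j)) (x \<omega>)) (iter_from f 0 (r (n j)) (x \<omega>')) \<le> D j"
    and D: "D \<longlonglongrightarrow> 0"
    and far: "\<And>j (\<omega> :: nat \<Rightarrow> bool) \<omega>'. \<omega> (fst (prod_decode j)) \<noteq> \<omega>' (fst (prod_decode j)) \<Longrightarrow>
      e \<le> dist (iter_from f 0 (r (q j)) (x \<omega>)) (iter_from f 0 (r (q j)) (x \<omega>'))"
    and "0 \<le> \<delta>" "\<delta> < e"
  shows "scrambled_set f \<delta> (range x)"
proof -
  let ?d = "\<lambda>\<omega> \<omega>' t. dist (iter_from f 0 t (x \<omega>)) (iter_from f 0 t (x \<omega>'))"
  have often: "\<exists>t\<ge>b. e \<le> ?d \<omega> \<omega>' t" if "\<omega> \<noteq> \<omega>'" for \<omega> \<omega>' :: "nat \<Rightarrow> bool" and b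
  proof -
    obtain c where c: "\<omega> c \<noteq> \<omega>' c" using \<open>\<omega> \<noteq> \<omega>'\<close> by blast
    obtain j where j: "j \<ge> b" "fst (prod_decode j) = c"
      using infinitely_often_fst_prod_decode by blast
    have "strict_mono (r \<circ> q)" using r q by (rule strict_mono_o)
    then have "b \<le> r (q j)" using strict_mono_imp_increasing[of "r \<circ> q" j] j(1) by simp
    moreover have "e \<le> ?d \<omega> \<omega>' (r (q j))" by (rule far) (simp add: j(2) c)
    ultimately show ?thesis by blast
  qed
  have "inj x"
  \<comment> \<open>Equal points have distance 0 at all times, whereas \<open>often\<close> yields a
    distance of at least \<open>e > 0\<close>.\<close>
  proof (rule injI, rule ccontr)
    fix \<omega> \<omega>' assume "x \<omega> = x \<omega>'" "\<omega> \<noteq> \<omega>'"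
    then show False using often[of \<omega> \<omega>' 0] \<open>0 \<le> \<delta>\<close> \<open>\<delta> < e\<close> by auto
  qed
  then have "uncountable (range x)"
    using uncountable_UNIV_nat_bool by (simp add: countable_image_inj_eq)
  moreover have "liminf (\<lambda>t. ereal (?d \<omega> \<omega>' t)) = 0" for \<omega> \<omega>'
  proof (rule liminf_eq_0_of_subseq)
    show "strict_mono (r \<circ> n)" using r n by (rule strict_mono_o)
    show "(\<lambda>j. ?d \<omega> \<omega>' ((r \<circ> n) j)) \<longlonglongrightarrow> 0"
      by (rule tendsto_sandwich[OF _ _ tendsto_const D]) (auto simp: close)
  qed simp
  moreover have "limsup (\<lambda>t. ereal (?d \<omega> \<omega>' t)) > ereal \<delta>" if "x \<omega> \<noteq> x \<omega>'" for \<omega> \<omega>'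
  proof -
    have "\<omega> \<noteq> \<omega>'" using that by blast
    then have "ereal e \<le> limsup (\<lambda>t. ereal (?d \<omega> \<omega>' t))"
      by (intro le_limsup_of_infinitely_often) (simp add: often)
    then show ?thesis using \<open>\<delta> < e\<close> by (meson ereal_less_eq(3) less_ereal.simps(1) less_le_trans)
  qed
  ultimately show ?thesis unfolding scrambled_set_def by auto
qed

section \<open>Assembly: from the matrix and the coupled expansion to a scrambled set\<close>

theorem corollary3p2:
  fixes f :: "nat \<Rightarrow> 'a::metric_space \<Rightarrow> 'a"
    and k :: "nat \<Rightarrow> nat"
    and fhat :: "nat \<Rightarrow> 'a \<Rightarrow> 'a"
    and N :: nat
    and A :: "nat mat"
    and V :: "nat \<Rightarrow> 'a set"
    and W :: "nat \<Rightarrow> nat \<Rightarrow> 'a set"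
  assumes k_incr: "strict_mono_on {1..} k" and k_pos: "\<forall>n\<ge>1. k n > 0"
    and fhat: "fhat = induced_map f k"
    and A: "transition_matrix N A" "irreducible_matrix N A"
    and A_row: "\<exists>i0<N. (\<Sum>j<N. A $$ (i0, j)) \<ge> 2"
    and V_disj: "disjoint_family_on V {..<N}"
    and V: "\<forall>i<N. V i \<noteq> {} \<and> compact (V i)"
    and cont: "\<forall>n. continuous_on (\<Union>i<N. V i) (fhat n)"
    and W: "\<forall>i<N. \<forall>n. W i n \<noteq> {} \<and> closed (W i n) \<and> W i n \<subseteq> V i"
    and expanding: "weakly_coupled_expanding N A fhat W"
    and shrinking: "\<exists>\<beta>\<in>one_sided_shift N A. \<exists>m :: nat \<Rightarrow> nat. \<exists>s0<N.
           strict_mono_on {1..} m \<and> (\<forall>j\<ge>1. m j > 0) \<and> (\<forall>j\<ge>1. \<beta> (m j) = s0) \<and>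
           (\<forall>n :: nat \<Rightarrow> nat. strict_mono_on {1..} n \<longrightarrow>
              (\<lambda>j. diameter (itinerary_set fhat W \<beta> (m j) (n j))) \<longlonglongrightarrow> 0)"
  shows "(\<exists>\<delta>>0. li_yorke_chaotic f \<delta>) \<and>
         (bounded (UNIV :: 'a set) \<longrightarrow> strong_li_yorke_chaotic f)"
proof -
  \<comment> \<open>Positivity matches the powers of \<open>A\<close> in the irreducibility
    condition; for entries in \<open>{0, 1}\<close> it amounts to being 1.\<close>
  define R where "R x y \<longleftrightarrow> x < N \<and> y < N \<and> A $$ (x, y) > 0" for x y
  have A01: "A $$ (x, y) = 1" if "R x y" for x y
    using A(1) that unfolding transition_matrix_def R_def by fastforce
  have conn: "\<exists>n p. walk R p n x y" if "x \<in> {..<N}" "y \<in> {..<N}" for x y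
  proof -
    obtain n where "(A ^\<^sub>m n) $$ (x, y) > 0"
      using A(2) \<open>x \<in> _\<close> \<open>y \<in> _\<close> unfolding irreducible_matrix_def by auto
    moreover have "A \<in> carrier_mat N N" using A(1) by (simp add: transition_matrix_def)
    ultimately show ?thesis
      using pow_mat_pos_imp_walk[of A N x y n] that unfolding R_def[abs_def] by auto
  qed
  obtain i where i: "i < N" "(\<Sum>j<N. A $$ (i, j)) \<ge> 2" using A_row by blast
  obtain j0 j1 where j: "j0 < N" "j1 < N" "j0 \<noteq> j1" "A $$ (i, j0) = 1" "A $$ (i, j1) = 1"
    using sum_ge_2_imp_two_ones[of "{..<N}" "\<lambda>j. A $$ (i, j)"] A(1) i
    unfolding transition_matrix_def by (metis finite_lessThan lessThan_iff)
  have "V j0 \<inter> V j1 = {}" using V_disj j by (simp add: disjoint_family_on_def)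
  then obtain e where e: "e > 0" "\<And>x y. x \<in> V j0 \<Longrightarrow> y \<in> V j1 \<Longrightarrow> e \<le> dist x y"
    using separate_compact_compact[of "V j0" "V j1"] V j by metis
  have e_sym: "e \<le> dist y x" if "x \<in> V j0" "y \<in> V j1" for x y
    using e(2)[OF that] by (simp add: dist_commute)
  obtain \<beta> m where \<beta>: "\<beta> \<in> one_sided_shift N A"
    and shrink: "\<And>n :: nat \<Rightarrow> nat. strict_mono_on {1..} n \<Longrightarrow>
      (\<lambda>j. diameter (itinerary_set fhat W \<beta> (m j) (n j))) \<longlonglongrightarrow> 0"
    using shrinking by blast
  have \<beta>': "\<beta> t \<in> {..<N}" "R (\<beta> t) (\<beta> (Suc t))" for t
    using \<beta> by (auto simp: one_sided_shift_def R_def)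
  obtain n q where n: "strict_mono n" and q: "strict_mono q"
    and it: "\<And>\<omega> :: nat \<Rightarrow> bool. \<exists>\<alpha>. (\<forall>t. R (\<alpha> t) (\<alpha> (Suc t))) \<and> (\<forall>k. \<forall>t\<le>m k. \<alpha> (n k + t) = \<beta> t) \<and>
               (\<forall>k. \<alpha> (q k) = (if \<omega> k then j1 else j0))"
    using exists_itineraries[of "{..<N}" R i j0 j1 \<beta> m, OF conn _ _ _ _ _ \<beta>'] i j
    by (auto simp: R_def)
  have "\<exists>x. (\<forall>j. iter_from fhat 0 (n j) x \<in> itinerary_set fhat W \<beta> (m j) (n j)) \<and>
      (\<forall>j. iter_from fhat 0 (q j) x \<in> V (if \<omega> (fst (prod_decode j)) then j1 else j0))"
    for \<omega> :: "nat \<Rightarrow> bool"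
  proof -
    obtain \<alpha> where \<alpha>: "\<And>t. R (\<alpha> t) (\<alpha> (Suc t))" "\<And>k t. t \<le> m k \<Longrightarrow> \<alpha> (n k + t) = \<beta> t"
        "\<And>k. \<alpha> (q k) = (if \<omega> (fst (prod_decode k)) then j1 else j0)"
      using it[of "\<lambda>k. \<omega> (fst (prod_decode k))"] by blast
    have \<alpha>N: "\<alpha> t < N" for t using \<alpha>(1) by (simp add: R_def)
    have "W (\<alpha> (Suc t)) (Suc t) \<subseteq> fhat t ` W (\<alpha> t) t" for t
    proof -
      have "(\<Union>j\<in>{j. j < N \<and> A $$ (\<alpha> t, j) = 1}. W j (Suc t)) \<subseteq> fhat t ` W (\<alpha> t) t"
        using expanding \<alpha>N[of t] unfolding weakly_coupled_expanding_def by blast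
      then show ?thesis using \<alpha>N[of "Suc t"] A01[OF \<alpha>(1)[of t]] by blast
    qed
    then obtain x where x: "\<And>t. iter_from fhat 0 t x \<in> W (\<alpha> t) t"
      using exists_point_of_itinerary[of "{..<N}" V fhat W \<alpha>] V cont W \<alpha>N by auto
    show ?thesis
    proof (intro exI[of _ x] conjI allI)
      show "iter_from fhat 0 (n j) x \<in> itinerary_set fhat W \<beta> (m j) (n j)" for j
        using x \<alpha>(2) by (rule itinerary_setI)
      show "iter_from fhat 0 (q j) x \<in> V (if \<omega> (fst (prod_decode j)) then j1 else j0)" for j
        using x[of "q j"] W \<alpha>N[of "q j"] unfolding \<alpha>(3) by blast
    qed
  qed
  then obtain x :: "(nat \<Rightarrow> bool) \<Rightarrow> 'a" where
    near: "\<And>\<omega> j. iter_from fhat 0 (n j) (x \<omega>) \<in> itinerary_set fhat W \<beta> (m j) (n j)" and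
    sep: "\<And>\<omega> j. iter_from fhat 0 (q j) (x \<omega>) \<in> V (if \<omega> (fst (prod_decode j)) then j1 else j0)"
    by metis
  \<comment> \<open>The time change from \<open>fhat\<close> to \<open>f\<close>. The value 0 at 0
    stands for the start of the orbit, and \<open>k_pos\<close> gives
    \<open>r 0 < r 1\<close>.\<close>
  define r where "r t = (if t = 0 then 0 else k t)" for t
  have r: "strict_mono r"
    unfolding strict_mono_Suc_iff r_def using k_pos strict_mono_onD[OF k_incr] by auto
  have iter: "iter_from fhat 0 t = iter_from f 0 (r t)" for t
    unfolding fhat r_def by (rule iter_from_induced_map[OF k_incr])
  \<comment> \<open>\<open>diameter\<close> is known to bound distances only on bounded sets. The
    constraint at time 0 alone places the set inside the compact
    \<open>V (\<beta> 0)\<close>.\<close>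
  have bdd: "bounded (itinerary_set fhat W \<beta> j t)" for j t
  proof (rule bounded_subset)
    show "bounded (V (\<beta> 0))" using V \<beta>'(1) compact_imp_bounded by auto
    have "itinerary_set fhat W \<beta> j t \<subseteq> W (\<beta> 0) t" by (force simp: itinerary_set_def)
    then show "itinerary_set fhat W \<beta> j t \<subseteq> V (\<beta> 0)" using W \<beta>'(1) by blast
  qed
  \<comment> \<open>The upper limit is only known to be at least \<open>e\<close>; halving gives the
    strict inequality.\<close>
  have scr: "scrambled_set f (e / 2) (range x)"
  proof (rule scrambled_set_of_itineraries[OF r n q])
    show "(\<lambda>j. diameter (itinerary_set fhat W \<beta> (m j) (n j))) \<longlonglongrightarrow> 0"
      using n by (intro shrink) (simp add: strict_mono_on_def strict_mono_def)
    show "dist (iter_from f 0 (r (n j)) (x \<omega>)) (iter_from f 0 (r (n j)) (x \<omega>'))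
        \<le> diameter (itinerary_set fhat W \<beta> (m j) (n j))" for j \<omega> \<omega>'
      using diameter_bounded_bound[OF bdd near near] by (simp add: iter)
    show "e \<le> dist (iter_from f 0 (r (q j)) (x \<omega>)) (iter_from f 0 (r (q j)) (x \<omega>'))"
      if "\<omega> (fst (prod_decode j)) \<noteq> \<omega>' (fst (prod_decode j))" for j \<omega> \<omega>'
      \<comment> \<open>Either of the two bits may be the true one; \<open>e_sym\<close> covers the
        swapped case.\<close>
      using that sep[of j \<omega>] sep[of j \<omega>'] e(2) e_sym by (auto simp: iter split: if_splits)
  qed (use e in auto)
  have "li_yorke_chaotic f (e / 2)" using scr e(1) by (auto simp: li_yorke_chaotic_def)
  moreover have "strong_li_yorke_chaotic f" if "bounded (UNIV :: 'a set)"
  proof -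
    have "bounded (B :: 'a set)" for B using that bounded_subset by blast
    then show ?thesis
      unfolding strong_li_yorke_chaotic_def using scr e(1) half_gt_zero by blast
  qed
  ultimately show ?thesis using e(1) half_gt_zero by blast
qed

end
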